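(* Let $n$ be a positive integer and let $p$ be a prime dividing $n$. Let $\omega_1:=e^{2\pi i/p}$, $\omega_j:=\omega_1^j$ for $0\le j\le p-1$, and $B:=\{1,\omega_1,\ldots,\omega_{p-1}\}^n\subseteq\mathbb{C}^n$. Let $K(n,p)$ be the minimum $k$ for which there exist vectors $v_1,\ldots,v_k\in B$ such that for every $w\in B$ there is an $i\in\{1,\ldots,k\}$ with $v_i\cdot w=0$. Then $K(n,p)\ge n(p-1)$.
   Context: Here $v\cdot w=\sum_{l=1}^n v_l w_l$ denotes the usual (bilinear, non-conjugated) scalar product of $v=(v_1,\dots,v_n)$ and $w=(w_1,\dots,w_n)$. *)

theory Defs
  imports Complex_Main "HOL-Computational_Algebra.Primes"
begin

text \<open>Vectors in C^n are modelled as functions nat => complex, with coordinates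
  0..n-1 (and value 0 outside, to make set membership canonical).\<close>

definition omega :: "nat \<Rightarrow> nat \<Rightarrow> complex" where
  "omega p j = (cis (2 * pi / real p)) ^ j"

definition roots :: "nat \<Rightarrow> complex set" where
  "roots p = {omega p j | j. j \<le> p - 1}"

definition Bset :: "nat \<Rightarrow> nat \<Rightarrow> (nat \<Rightarrow> complex) set" where
  "Bset n p = {v. (\<forall>l<n. v l \<in> roots p) \<and> (\<forall>l\<ge>n. v l = 0)}"

definition dotp :: "nat \<Rightarrow> (nat \<Rightarrow> complex) \<Rightarrow> (nat \<Rightarrow> complex) \<Rightarrow> complex" where
  "dotp n v w = (\<Sum>l<n. v l * w l)"

definition Kval :: "nat \<Rightarrow> nat \<Rightarrow> nat" where
  "Kval n p = (LEAST k. \<exists>v :: nat \<Rightarrow> nat \<Rightarrow> complex.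
      (\<forall>i\<in>{1..k}. v i \<in> Bset n p) \<and>
      (\<forall>w\<in>Bset n p. \<exists>i\<in>{1..k}. dotp n (v i) w = 0))"

end

theory Submission
  imports Defs "HOL-Computational_Algebra.Polynomial_Factorial" "HOL-Number_Theory.Cong"
    "HOL-Library.Real_Mod"
begin

text \<open>
  Write \<open>\<chi>(w)\<close> for the product of the coordinates of \<open>w\<close>. Irreducibility of the \<open>p\<close>-th
  cyclotomic polynomial shows that \<open>v \<cdot> w = 0\<close> forces \<open>\<chi>(v) \<chi>(w)\<close> to be a fixed root of unity
  \<open>\<kappa>\<close>. Hence the vectors \<open>v\<^sub>i\<close> with \<open>\<chi>(v\<^sub>i) = s\<close> must cover exactly the level set
  \<open>\<chi>(w) = \<kappa>/s\<close>, and it suffices that each of these \<open>p\<close> classes has at least \<open>n(p - 1)/p\<close> members.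

  If a class has \<open>d\<close> members, the product \<open>f(w)\<close> of its linear forms \<open>v\<^sub>i \<cdot> w\<close> is homogeneous of
  degree \<open>d\<close>, vanishes on the level set \<open>\<chi> = t\<close>, and is nonzero off it. Thus
  \<open>f \<cdot> \<Sum>\<^sub>j (\<chi>/t)^j = 0\<close> on \<open>B\<close>, with \<open>0 \<le> j < p\<close>. Two monomials \<open>w^a\<close> and \<open>w^b\<close> of \<open>f\<close> can only
  satisfy \<open>w^a \<chi>^j = w^b\<close> on \<open>B\<close> if \<open>b \<equiv> a + j\<close> modulo \<open>p\<close> in every coordinate. For \<open>0 < j\<close> then
  \<open>j a\<^sub>l + (p - j) b\<^sub>l \<ge> j (p - j)\<close> for all \<open>l\<close>, and summing over \<open>l\<close> gives
  \<open>p d \<ge> n j (p - j) \<ge> n (p - 1)\<close>. So if \<open>p d < n (p - 1)\<close>, all \<open>f \<chi>^j\<close> with \<open>0 < j\<close> are orthogonal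
  to \<open>f\<close>, and pairing the vanishing sum with \<open>f\<close> shows that \<open>f\<close> is zero on all of \<open>B\<close>.
\<close>

subsection \<open>Irreducibility of the prime cyclotomic polynomials\<close>

lemma eisenstein_factor_degree_eq_0:
  fixes f g h :: "'a :: idom poly"
  assumes q: "prime_elem q" and f: "f = g * h"
    and low: "\<And>i. i < degree f \<Longrightarrow> q dvd coeff f i"
    and lead: "\<not> q dvd lead_coeff f" and h0: "\<not> q dvd coeff h 0"
  shows "degree h = 0"
proof -
  have "g \<noteq> 0" "h \<noteq> 0" using f lead by auto
  then have deg: "degree f = degree g + degree h" by (simp add: f degree_mult_eq)
  have "\<not> q dvd lead_coeff g" using lead f by (auto simp: lead_coeff_mult)
  then have ex: "\<exists>k. \<not> q dvd coeff g k" by blast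
  define k where "k = (LEAST k. \<not> q dvd coeff g k)"
  have k: "\<not> q dvd coeff g k" unfolding k_def by (rule LeastI_ex[OF ex])
  have below_k: "q dvd coeff g i" if "i < k" for i
    using not_less_Least that unfolding k_def by blast
  have "coeff f k = coeff g k * coeff h 0 + (\<Sum>i<k. coeff g i * coeff h (k - i))"
    unfolding f coeff_mult by (simp add: lessThan_Suc_atMost[symmetric])
  moreover have "q dvd (\<Sum>i<k. coeff g i * coeff h (k - i))"
    using below_k by (intro dvd_sum) auto
  moreover have "\<not> q dvd coeff g k * coeff h 0"
    using k h0 q by (simp add: prime_elem_dvd_mult_iff)
  ultimately have "\<not> q dvd coeff f k" by (simp add: dvd_add_left_iff)
  then have "degree f \<le> k" using low by (meson not_le)
  moreover have "k \<le> degree g" using k by (intro le_degree) auto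
  ultimately show ?thesis using deg by simp
qed

theorem eisenstein_irreducible_monic:
  fixes f :: "'a :: idom poly"
  assumes q: "prime_elem q" and monic: "lead_coeff f = 1" and deg: "degree f > 0"
    and low: "\<And>i. i < degree f \<Longrightarrow> q dvd coeff f i" and const: "\<not> q\<^sup>2 dvd coeff f 0"
  shows "irreducible f"
proof (rule irreducibleI)
  show "f \<noteq> 0" "\<not> f dvd 1" using deg by (auto simp: is_unit_poly_iff)
next
  fix g h assume f: "f = g * h"
  have lead: "\<not> q dvd lead_coeff f" using q monic by (auto dest: prime_elem_not_unit)
  have "\<not> q dvd coeff g 0 \<or> \<not> q dvd coeff h 0"
    using const unfolding f coeff_mult_0 power2_eq_square by (meson mult_dvd_mono)
  then have "degree h = 0 \<or> degree g = 0"
    using eisenstein_factor_degree_eq_0[OF q _ low lead] f by (metis mult.commute)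
  moreover have "lead_coeff g * lead_coeff h = 1" using monic f by (simp add: lead_coeff_mult)
  ultimately show "g dvd 1 \<or> h dvd 1"
    by (metis degree_eq_zeroE dvd_triv_left dvd_triv_right is_unit_const_poly_iff
        lead_coeff_pCons(2))
qed

lemma irreducible_pcompose_imp_irreducible:
  fixes f g :: "'a :: idom poly"
  assumes irred: "irreducible (pcompose f g)" and deg: "degree g > 0"
  shows "irreducible f"
proof -
  have unit: "h dvd 1" if "pcompose h g dvd 1" for h
  proof -
    have "degree (pcompose h g) = 0" using that by (auto simp: is_unit_poly_iff)
    then have "degree h = 0" using deg by (simp add: degree_pcompose)
    then show ?thesis using that by (metis degree_eq_zeroE pcompose_const)
  qed
  have "\<not> f dvd 1"
  proof
    assume "f dvd 1"
    then have "pcompose f g dvd 1" by (auto simp: is_unit_poly_iff)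
    with irred show False by (simp add: irreducible_not_unit)
  qed
  moreover have "g1 dvd 1 \<or> g2 dvd 1" if "f = g1 * g2" for g1 g2
    using irreducibleD[OF irred, of "pcompose g1 g" "pcompose g2 g"] unit that
    by (auto simp: pcompose_mult)
  ultimately show ?thesis using irred by (auto simp: irreducible_def)
qed

definition cyclotomic_prime :: "nat \<Rightarrow> int poly" where
  "cyclotomic_prime p = (\<Sum>i<p. monom 1 i)"

lemma coeff_cyclotomic_prime_shifted:
  "coeff (pcompose (cyclotomic_prime p) [:1, 1:]) i = int (p choose Suc i)"
proof -
  have "pcompose (monom 1 i) g = g ^ i" for i and g :: "int poly"
    by (induction i) (simp_all add: monom_Suc pcompose_pCons one_pCons)
  then have "pcompose (cyclotomic_prime p) [:1, 1:] = (\<Sum>i<p. [:1, 1:] ^ i)"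
    unfolding cyclotomic_prime_def by (simp add: pcompose_sum)
  then have "[:0, 1:] * pcompose (cyclotomic_prime p) [:1, 1:] = [:1, 1:] ^ p - 1"
    using power_diff_1_eq[of "[:1, 1:] :: int poly" p] by (simp add: one_pCons)
  then have "coeff ([:0, 1:] * pcompose (cyclotomic_prime p) [:1, 1:]) (Suc i)
      = coeff ([:1, 1:] ^ p - 1 :: int poly) (Suc i)" by simp
  moreover have "coeff ([:1, 1:] ^ p :: int poly) (Suc i) = int (p choose Suc i)"
    by (cases "Suc i \<le> p")
       (auto simp: coeff_linear_poly_power binomial_eq_0
         intro!: coeff_eq_0 le_less_trans[OF degree_power_le])
  ultimately show ?thesis by simp
qed

lemma irreducible_cyclotomic_prime:
  assumes p: "prime p"
  shows "irreducible (cyclotomic_prime p)"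
proof -
  let ?f = "pcompose (cyclotomic_prime p) [:1, 1:]"
  note coeff = coeff_cyclotomic_prime_shifted[of p]
  have p_gt_1: "p > 1" using p by (rule prime_gt_1_nat)
  have deg: "degree ?f = p - 1"
  proof (rule antisym)
    show "degree ?f \<le> p - 1" by (rule degree_le) (auto simp: coeff)
    show "p - 1 \<le> degree ?f" by (rule le_degree) (use p_gt_1 in \<open>simp add: coeff\<close>)
  qed
  have "irreducible ?f"
  proof (rule eisenstein_irreducible_monic)
    show "prime_elem (int p)" using p by simp
    show "lead_coeff ?f = 1" "degree ?f > 0" using p_gt_1 unfolding deg by (simp_all add: coeff)
    show "int p dvd coeff ?f i" if "i < degree ?f" for i
      using that p unfolding deg coeff by (auto intro!: dvd_choose_prime simp: int_dvd_int_iff)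
    show "\<not> (int p)\<^sup>2 dvd coeff ?f 0" using p_gt_1 unfolding coeff by (simp add: power2_eq_square)
  qed
  then show ?thesis by (rule irreducible_pcompose_imp_irreducible) simp
qed

subsection \<open>Vanishing sums of roots of unity\<close>

abbreviation int_poly_eval :: "int poly \<Rightarrow> 'a :: comm_ring_1 \<Rightarrow> 'a" where
  "int_poly_eval f z \<equiv> poly (map_poly of_int f) z"

lemma int_poly_eval_add: "int_poly_eval (f + g) z = int_poly_eval f z + int_poly_eval g z"
proof -
  have "map_poly of_int (f + g) = (map_poly of_int f + map_poly of_int g :: 'a poly)"
    by (intro poly_eqI) (simp add: coeff_map_poly)
  then show ?thesis by simp
qed

lemma int_poly_eval_mult: "int_poly_eval (f * g) z = int_poly_eval f z * int_poly_eval g z"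
proof -
  have "map_poly of_int (f * g) = (map_poly of_int f * map_poly of_int g :: 'a poly)"
    by (intro poly_eqI) (simp add: coeff_map_poly coeff_mult)
  then show ?thesis by simp
qed

lemma int_poly_eval_smult: "int_poly_eval (smult c f) z = of_int c * int_poly_eval f z"
  by (simp add: map_poly_smult)

lemma int_poly_eval_sum_monom:
  "int_poly_eval (\<Sum>l\<in>A. monom 1 (e l)) z = (\<Sum>l\<in>A. z ^ e l)"
  by (induction A rule: infinite_finite_induct)
     (simp_all add: int_poly_eval_add map_poly_monom poly_monom)

lemma minimal_int_polyE:
  fixes z :: "'a :: {idom, ring_char_0}"
  assumes "h \<noteq> 0" "int_poly_eval h z = 0"
  obtains m where "\<And>f. int_poly_eval f z = 0 \<longleftrightarrow> m dvd f"
proof -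
  obtain f_min where f_min: "f_min \<noteq> 0" "int_poly_eval f_min z = 0"
    and minimal: "\<And>f. f \<noteq> 0 \<Longrightarrow> int_poly_eval f z = 0 \<Longrightarrow> degree f_min \<le> degree f"
    using ex_has_least_nat[of "\<lambda>f. f \<noteq> 0 \<and> int_poly_eval f z = 0" h degree] assms by auto
  define m where "m = primitive_part f_min"
  have m: "m \<noteq> 0" "content m = 1" "degree m = degree f_min" using f_min by (simp_all add: m_def)
  have "int_poly_eval f_min z = of_int (content f_min) * int_poly_eval m z"
    unfolding m_def by (subst int_poly_eval_smult[symmetric]) simp
  then have m_root: "int_poly_eval m z = 0" using f_min by simp
  have "m dvd f" if f: "int_poly_eval f z = 0" for f
  proof -
    obtain a g where a: "a \<noteq> 0" and division: "smult a f = m * g + pseudo_mod f m"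
      using pseudo_mod(1)[OF m(1)] by blast
    have "int_poly_eval (pseudo_mod f m) z = 0"
      using arg_cong[OF division, of "\<lambda>f. int_poly_eval f z"] f m_root
      by (simp add: int_poly_eval_add int_poly_eval_mult int_poly_eval_smult)
    then have "pseudo_mod f m = 0"
      using pseudo_mod(2)[OF m(1), of f] minimal[of "pseudo_mod f m"] m(3) by linarith
    then have "smult a f = m * g" using division by simp
    then have "fract_poly m dvd smult (to_fract a) (fract_poly f)"
      by (metis dvd_triv_left fract_poly_dvd fract_poly_smult)
    then have "fract_poly m dvd fract_poly f" using a by (simp add: dvd_smult_iff)
    then show ?thesis using m(2) by (rule fract_poly_dvdD)
  qed
  then show thesis using m_root by (intro that[of m]) (auto simp: int_poly_eval_mult)
qed

lemma irreducible_dvd_if_common_root: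
  fixes z :: "'a :: {idom, ring_char_0}"
  assumes h: "irreducible h" "int_poly_eval h z = 0" and f: "int_poly_eval f z = 0"
  shows "h dvd f"
proof -
  obtain m where m: "\<And>f. int_poly_eval f z = 0 \<longleftrightarrow> m dvd f"
    using minimal_int_polyE[of h z] h by (auto simp: irreducible_def)
  have "\<not> m dvd 1" using m[of 1] by simp
  moreover have "m dvd h" using h m by blast
  ultimately have "h dvd m" using h(1) by (auto dest: irreducibleD')
  then show ?thesis using m f by (auto intro: dvd_trans)
qed

text \<open>Compare values and first derivatives at 1 in
  \<open>(\<Sum>l. x ^ a l) = (1 + x + \<dots> + x ^ (p - 1)) * Q\<close>.\<close>

lemma sum_exponents_cong_if_sum_powers_eq_0:
  fixes z :: "'a :: {idom, ring_char_0}" and a :: "nat \<Rightarrow> nat"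
  assumes p: "prime p" and z: "z ^ p = 1" "z \<noteq> 1" and vanish: "(\<Sum>l<n. z ^ a l) = 0"
  shows "[(\<Sum>l<n. a l) = (\<Sum>i<p. i) * (n div p)] (mod p)"
proof -
  have "(z - 1) * (\<Sum>i<p. z ^ i) = 0" using z by (simp flip: power_diff_1_eq)
  then have "int_poly_eval (cyclotomic_prime p) z = 0"
    using z by (simp add: cyclotomic_prime_def int_poly_eval_sum_monom)
  moreover have "int_poly_eval (\<Sum>l<n. monom 1 (a l)) z = 0"
    unfolding int_poly_eval_sum_monom by (rule vanish)
  ultimately obtain Q where Q: "(\<Sum>l<n. monom 1 (a l)) = cyclotomic_prime p * Q"
    using irreducible_dvd_if_common_root[OF irreducible_cyclotomic_prime[OF p]] by blast
  have value_at_1: "poly (\<Sum>i<k. monom 1 (e i)) 1 = int k" for k :: nat and e :: "nat \<Rightarrow> nat"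
    by (simp add: poly_sum poly_monom)
  have deriv_at_1: "poly (pderiv (\<Sum>i<k. monom 1 (e i))) 1 = int (\<Sum>i<k. e i)"
    for k and e :: "nat \<Rightarrow> nat"
    by (induction k) (simp_all add: pderiv_add pderiv_monom poly_monom)
  have "int n = int p * poly Q 1"
    using arg_cong[OF Q, of "\<lambda>f. poly f 1"] value_at_1[of a n] value_at_1[of "\<lambda>i. i" p]
    by (simp add: cyclotomic_prime_def)
  then have "poly Q 1 = int (n div p)"
    using p prime_gt_0_nat[of p] by (simp add: zdiv_int)
  moreover have "int (\<Sum>l<n. a l) = int p * poly (pderiv Q) 1 + int (\<Sum>i<p. i) * poly Q 1"
    using arg_cong[OF Q, of "\<lambda>f. poly (pderiv f) 1"] deriv_at_1[of a n] deriv_at_1[of "\<lambda>i. i" p]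
      value_at_1[of "\<lambda>i. i" p]
    by (simp add: cyclotomic_prime_def pderiv_mult mult.commute)
  ultimately have "[int (\<Sum>l<n. a l) = int ((\<Sum>i<p. i) * (n div p))] (mod int p)"
    by (simp add: cong_def)
  then show ?thesis by (simp only: cong_int_iff)
qed

subsection \<open>The group of vectors of roots of unity\<close>

lemma omega_eq_cis: "omega p j = cis (2 * pi * real j / real p)"
  by (simp add: omega_def DeMoivre mult_ac)

lemma omega_add: "omega p (i + j) = omega p i * omega p j"
  by (simp add: omega_def power_add)

lemma omega_power: "omega p i ^ j = omega p (i * j)"
  by (simp add: omega_def power_mult)

lemma omega_eq_1_iff:
  assumes "p > 0"
  shows "omega p j = 1 \<longleftrightarrow> p dvd j"
proof -
  have "2 * pi * real j / real p = of_int m * (2 * pi) \<longleftrightarrow> int j = int p * m" for m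
  proof -
    have "2 * pi * real j / real p = of_int m * (2 * pi) \<longleftrightarrow> real j = real p * of_int m"
      using assms by (auto simp: field_simps)
    also have "\<dots> \<longleftrightarrow> real_of_int (int j) = real_of_int (int p * m)" by simp
    finally show ?thesis by (simp only: of_int_eq_iff)
  qed
  then have "omega p j = 1 \<longleftrightarrow> int p dvd int j"
    by (simp only: omega_eq_cis cis_eq_1_iff dvd_def)
  then show ?thesis by simp
qed

lemma omega_cong:
  assumes "p > 0" and "[i = j] (mod p)"
  shows "omega p i = omega p j"
proof -
  have "omega p k = omega p (k mod p)" for k
  proof -
    have "omega p (p * (k div p)) = 1" by (simp add: omega_eq_1_iff[OF assms(1)])
    then show ?thesis using omega_add[of p "p * (k div p)" "k mod p"] by simp
  qed
  then show ?thesis using assms(2) by (metis cong_def)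
qed

lemma roots_eq:
  assumes "p > 0"
  shows "roots p = {z. z ^ p = 1}"
proof -
  have "j \<le> p - 1 \<longleftrightarrow> j < p" for j using assms by auto
  then have "roots p = omega p ` {..<p}" by (auto simp: roots_def)
  also have "\<dots> = {z. z ^ p = 1}"
    using bij_betw_roots_unity[OF assms] by (simp add: bij_betw_def omega_eq_cis)
  finally show ?thesis .
qed

lemma omega_in_roots: "p > 0 \<Longrightarrow> omega p j \<in> roots p"
  by (simp add: roots_eq omega_power omega_eq_1_iff)

lemma one_in_roots: "p > 0 \<Longrightarrow> 1 \<in> roots p"
  by (simp add: roots_eq)

lemma roots_mult: "p > 0 \<Longrightarrow> y \<in> roots p \<Longrightarrow> z \<in> roots p \<Longrightarrow> y * z \<in> roots p"
  by (simp add: roots_eq power_mult_distrib)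

lemma roots_inverse: "p > 0 \<Longrightarrow> z \<in> roots p \<Longrightarrow> inverse z \<in> roots p"
  by (simp add: roots_eq power_inverse)

lemma roots_nonzero: "p > 0 \<Longrightarrow> z \<in> roots p \<Longrightarrow> z \<noteq> 0"
  by (auto simp: roots_eq zero_power)

lemma finite_roots: "p > 0 \<Longrightarrow> finite (roots p)"
  by (simp add: roots_eq finite_roots_unity Suc_le_eq)

lemma card_roots: "p > 0 \<Longrightarrow> card (roots p) = p"
  by (simp add: roots_eq card_roots_unity_eq)

lemma cnj_root_of_unity:
  assumes "p > 0" "z \<in> roots p"
  shows "cnj z = z ^ (p - 1)"
proof -
  have z: "z ^ p = 1" using assms by (simp add: roots_eq)
  then have "norm z = 1"
    using assms(1) by (metis norm_one norm_power power_eq_1_iff norm_ge_zero less_not_refl)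
  then have "cnj z * z = 1" by (metis complex_norm_square mult.commute of_real_1 power_one)
  moreover have "z ^ (p - 1) * z = 1" using z assms(1) by (simp add: power_eq_if mult.commute)
  ultimately show ?thesis by (metis mult_cancel_right mult_zero_right zero_neq_one)
qed

lemma finite_Bset:
  assumes "p > 0"
  shows "finite (Bset n p)"
proof -
  have "Bset n p = {f. \<forall>x. (x \<in> {..<n} \<longrightarrow> f x \<in> roots p) \<and> (x \<notin> {..<n} \<longrightarrow> f x = 0)}"
    by (auto simp: Bset_def not_less)
  then show ?thesis
    using finite_set_of_finite_funs[OF finite_lessThan[of n] finite_roots[OF assms], of 0] by simp
qed

lemma Bset_mult:
  "p > 0 \<Longrightarrow> v \<in> Bset n p \<Longrightarrow> w \<in> Bset n p \<Longrightarrow> (\<lambda>l. v l * w l) \<in> Bset n p"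
  by (simp add: Bset_def roots_mult)

text \<open>The coordinates from \<open>n\<close> on stay zero because of the convention \<open>inverse 0 = 0\<close>.\<close>

lemma Bset_inverse: "p > 0 \<Longrightarrow> w \<in> Bset n p \<Longrightarrow> (\<lambda>l. inverse (w l)) \<in> Bset n p"
  by (simp add: Bset_def roots_inverse)

lemma inverse_mult_cancel_Bset:
  assumes "p > 0" "u \<in> Bset n p" "w \<in> Bset n p"
  shows "inverse (u l) * (u l * w l) = w l"
proof (cases "l < n")
  case True
  then have "u l \<noteq> 0" using assms roots_nonzero by (auto simp: Bset_def)
  then show ?thesis by simp
next
  case False
  then show ?thesis using assms(3) by (simp add: Bset_def)
qed

lemma sum_Bset_translate:
  assumes p: "p > 0" and u: "u \<in> Bset n p"
  shows "(\<Sum>w\<in>Bset n p. F (\<lambda>l. u l * w l)) = (\<Sum>w\<in>Bset n p. F w)"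
proof (rule sum.reindex_bij_witness[where j = "\<lambda>w l. u l * w l"
        and i = "\<lambda>w l. inverse (u l) * w l"])
  have u_inv: "(\<lambda>l. inverse (u l)) \<in> Bset n p" by (rule Bset_inverse[OF p u])
  fix w assume w: "w \<in> Bset n p"
  show "(\<lambda>l. inverse (u l) * (u l * w l)) = w"
    by (intro ext inverse_mult_cancel_Bset[OF p u w])
  show "(\<lambda>l. u l * (inverse (u l) * w l)) = w"
    using inverse_mult_cancel_Bset[OF p u_inv w] by (simp only: inverse_inverse_eq)
  show "(\<lambda>l. u l * w l) \<in> Bset n p" by (rule Bset_mult[OF p u w])
  show "(\<lambda>l. inverse (u l) * w l) \<in> Bset n p" by (rule Bset_mult[OF p u_inv w])
qed simp

subsection \<open>Monomials\<close>

definition monomial :: "nat \<Rightarrow> (nat \<Rightarrow> nat) \<Rightarrow> (nat \<Rightarrow> 'a :: comm_semiring_1) \<Rightarrow> 'a" where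
  "monomial n a w = (\<Prod>l<n. w l ^ a l)"

definition coord_prod :: "nat \<Rightarrow> (nat \<Rightarrow> 'a :: comm_semiring_1) \<Rightarrow> 'a" where
  "coord_prod n w = (\<Prod>l<n. w l)"

definition single_coord :: "nat \<Rightarrow> nat \<Rightarrow> 'a \<Rightarrow> nat \<Rightarrow> 'a :: zero_neq_one" where
  "single_coord n k y = (\<lambda>l. if l < n then if l = k then y else 1 else 0)"

lemma monomial_mult: "monomial n a (\<lambda>l. v l * w l) = monomial n a v * monomial n a w"
  by (simp add: monomial_def power_mult_distrib prod.distrib)

lemma monomial_add: "monomial n (\<lambda>l. a l + b l) w = monomial n a w * monomial n b w"
  by (simp add: monomial_def power_add prod.distrib)

lemma coord_prod_power: "coord_prod n w ^ j = monomial n (\<lambda>_. j) w"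
  by (simp add: monomial_def coord_prod_def prod_power_distrib)

lemma monomial_single_coord:
  fixes y :: "'a :: comm_semiring_1"
  assumes "k < n"
  shows "monomial n a (single_coord n k y) = y ^ a k"
proof -
  have "monomial n a (single_coord n k y) = (\<Prod>l<n. if l = k then y ^ a k else 1)"
    unfolding monomial_def single_coord_def by (intro prod.cong) auto
  then show ?thesis using assms by simp
qed

lemma single_coord_in_Bset: "p > 0 \<Longrightarrow> y \<in> roots p \<Longrightarrow> single_coord n k y \<in> Bset n p"
  by (auto simp: Bset_def single_coord_def one_in_roots)

lemma coord_prod_in_roots: "p > 0 \<Longrightarrow> w \<in> Bset n p \<Longrightarrow> coord_prod n w \<in> roots p"
  by (simp add: roots_eq Bset_def coord_prod_def prod_power_distrib)

lemma coord_prod_image_Bset: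
  assumes p: "p > 0" and n: "n > 0"
  shows "coord_prod n ` Bset n p = roots p"
proof (intro equalityI subsetI)
  show "z \<in> roots p" if "z \<in> coord_prod n ` Bset n p" for z
    using that coord_prod_in_roots[OF p] by blast
next
  fix z assume z: "z \<in> roots p"
  have "coord_prod n (single_coord n 0 z) = z"
    using monomial_single_coord[OF n, of "\<lambda>_. 1" z] coord_prod_power[of n "single_coord n 0 z" 1]
    by simp
  then show "z \<in> coord_prod n ` Bset n p"
    using single_coord_in_Bset[OF p z] by (metis image_eqI)
qed

lemma cnj_monomial_Bset:
  assumes "p > 0" "w \<in> Bset n p"
  shows "cnj (monomial n a w) = monomial n (\<lambda>l. (p - 1) * a l) w"
  unfolding monomial_def cnj_prod
  using assms by (intro prod.cong) (simp_all add: Bset_def cnj_root_of_unity power_mult)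

lemma sum_monomial_Bset:
  assumes p: "p > 0" and k: "k < n" "\<not> p dvd a k"
  shows "(\<Sum>w\<in>Bset n p. monomial n a w) = 0"
proof -
  let ?u = "single_coord n k (omega p 1)"
  have "(\<Sum>w\<in>Bset n p. monomial n a w) = (\<Sum>w\<in>Bset n p. monomial n a (\<lambda>l. ?u l * w l))"
    by (intro sum_Bset_translate[symmetric] single_coord_in_Bset omega_in_roots p)
  also have "\<dots> = omega p (a k) * (\<Sum>w\<in>Bset n p. monomial n a w)"
    using k by (simp add: monomial_mult monomial_single_coord omega_power sum_distrib_left)
  finally show ?thesis using omega_eq_1_iff[OF p, of "a k"] k(2) by simp
qed

subsection \<open>Orthogonal vectors\<close>

definition orthogonality_const :: "nat \<Rightarrow> nat \<Rightarrow> complex" where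
  "orthogonality_const n p = omega p ((\<Sum>i<p. i) * (n div p))"

lemma dotp_eq_0_imp_coord_prod:
  assumes p: "prime p" and v: "v \<in> Bset n p" and w: "w \<in> Bset n p" and orth: "dotp n v w = 0"
  shows "coord_prod n v * coord_prod n w = orthogonality_const n p"
proof -
  have p_gt_1: "p > 1" and p_pos: "p > 0" using prime_gt_1_nat[OF p] by simp_all
  have "\<exists>a. v l * w l = omega p 1 ^ a" if "l < n" for l
  proof -
    have "v l * w l \<in> roots p" using v w that p_pos by (auto simp: Bset_def intro: roots_mult)
    then show ?thesis by (auto simp: roots_def omega_def)
  qed
  then obtain a where a: "\<And>l. l < n \<Longrightarrow> v l * w l = omega p 1 ^ a l" by metis
  have "(\<Sum>l<n. omega p 1 ^ a l) = 0" using orth a by (simp add: dotp_def)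
  then have "[(\<Sum>l<n. a l) = (\<Sum>i<p. i) * (n div p)] (mod p)"
    using p_gt_1 by (intro sum_exponents_cong_if_sum_powers_eq_0[OF p, of "omega p 1"])
      (simp_all add: omega_power omega_eq_1_iff)
  moreover have "coord_prod n v * coord_prod n w = omega p (\<Sum>l<n. a l)"
    using a by (simp add: coord_prod_def omega_def power_sum flip: prod.distrib)
  ultimately show ?thesis
    unfolding orthogonality_const_def using omega_cong[OF p_pos] by simp
qed

lemma ex_orthogonal_vector_in_Bset:
  assumes p: "p > 1" and n: "p dvd n" and w: "w \<in> Bset n p"
  shows "\<exists>v\<in>Bset n p. dotp n v w = 0"
proof
  have p_pos: "p > 0" using p by simp
  define v where "v = (\<lambda>l. inverse (w l) * omega p l)"
  show "v \<in> Bset n p"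
    using w p_pos by (auto simp: v_def Bset_def intro!: roots_mult roots_inverse omega_in_roots)
  have "v l * w l = omega p l" if "l < n" for l
    using w roots_nonzero[OF p_pos, of "w l"] that by (simp add: Bset_def v_def)
  then have "dotp n v w = (\<Sum>l<n. omega p 1 ^ l)" by (simp add: dotp_def omega_power)
  also have "\<dots> = (omega p 1 ^ n - 1) / (omega p 1 - 1)"
    using p by (intro geometric_sum) (simp add: omega_eq_1_iff)
  also have "\<dots> = 0" using n p_pos by (simp add: omega_power omega_eq_1_iff)
  finally show "dotp n v w = 0" .
qed

subsection \<open>Homogeneous forms\<close>

inductive homogeneous :: "nat \<Rightarrow> nat \<Rightarrow> ((nat \<Rightarrow> 'a :: comm_semiring_1) \<Rightarrow> 'a) \<Rightarrow> bool"
  for n d where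
  zero: "homogeneous n d (\<lambda>_. 0)"
| monomial: "(\<Sum>l<n. a l) = d \<Longrightarrow> homogeneous n d (\<lambda>w. c * monomial n a w)"
| add: "homogeneous n d f \<Longrightarrow> homogeneous n d g \<Longrightarrow> homogeneous n d (\<lambda>w. f w + g w)"

lemma homogeneous_sum:
  "(\<And>i. i \<in> I \<Longrightarrow> homogeneous n d (f i)) \<Longrightarrow> homogeneous n d (\<lambda>w. \<Sum>i\<in>I. f i w)"
  by (induction I rule: infinite_finite_induct) (auto intro: homogeneous.intros)

lemma homogeneous_mult:
  assumes f: "homogeneous n d f" and g: "homogeneous n e g"
  shows "homogeneous n (d + e) (\<lambda>w. f w * g w)"
  using f
proof induction
  case zero
  then show ?case by (simp add: homogeneous.zero)
next
  case (monomial a c)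
  show ?case
    using g
  proof induction
    case zero
    then show ?case by (simp add: homogeneous.zero)
  next
    case (monomial b c')
    have "homogeneous n (d + e) (\<lambda>w. (c * c') * monomial n (\<lambda>l. a l + b l) w)"
      using \<open>(\<Sum>l<n. a l) = d\<close> monomial by (intro homogeneous.monomial) (simp add: sum.distrib)
    then show ?case by (simp add: monomial_add mult_ac)
  next
    case (add g h)
    then show ?case by (auto simp: distrib_left intro: homogeneous.add)
  qed
next
  case (add f h)
  then show ?case by (auto simp: distrib_right intro: homogeneous.add)
qed

lemma homogeneous_prod:
  assumes "finite I" and "\<And>i. i \<in> I \<Longrightarrow> homogeneous n (d i) (f i)"
  shows "homogeneous n (\<Sum>i\<in>I. d i) (\<lambda>w. \<Prod>i\<in>I. f i w)"
  using assms
proof (induction I)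
  case empty
  have "homogeneous n 0 (\<lambda>w. 1 * monomial n (\<lambda>_. 0) w)" by (rule homogeneous.monomial) simp
  then show ?case by (simp add: monomial_def)
next
  case (insert i I)
  then show ?case by (simp add: homogeneous_mult)
qed

lemma homogeneous_dotp: "homogeneous n 1 (dotp n v)"
proof -
  have "homogeneous n 1 (\<lambda>w. v l * w l)" if "l < n" for l
  proof -
    have "homogeneous n 1 (\<lambda>w. v l * monomial n (\<lambda>i. if i = l then 1 else 0) w)"
      using that by (intro homogeneous.monomial) simp
    moreover have "monomial n (\<lambda>i. if i = l then 1 else 0) w = w l" for w :: "nat \<Rightarrow> complex"
      using that by (simp add: monomial_def if_distrib[of "\<lambda>k. _ ^ k"] cong: if_cong)
    ultimately show ?thesis by simp
  qed
  then show ?thesis unfolding dotp_def by (intro homogeneous_sum) simp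
qed

lemma mult_diff_le_weighted_exponents:
  fixes a b j p :: nat
  assumes "0 < j" "j < p" "p dvd a + j + (p - 1) * b"
  shows "j * (p - j) \<le> j * a + (p - j) * b"
proof (cases "p - j \<le> a")
  case True
  then show ?thesis by (simp add: trans_le_add1)
next
  case False
  have "a + j + (p - 1) * b + b = p * b + (a + j)" using assms by (cases p) simp_all
  then have "[b = a + j] (mod p)"
    using assms(3) by (metis cong_def dvd_imp_mod_0 mod_add_left_eq add_0 mod_mult_self4)
  then have "b mod p = a + j" using False by (simp add: cong_def)
  then have "j \<le> b" using mod_less_eq_dividend[of b p] by simp
  then have "(p - j) * j \<le> (p - j) * b" by (rule mult_le_mono2)
  then show ?thesis by (metis mult.commute trans_le_add2)
qed

lemma sum_monomial_shift_orthogonal: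
  assumes j: "0 < j" "j < p" and deg: "(\<Sum>l<n. a l) = d" "(\<Sum>l<n. b l) = d"
    and small: "p * d < n * (j * (p - j))"
  shows "(\<Sum>w\<in>Bset n p. monomial n a w * coord_prod n w ^ j * cnj (monomial n b w)) = 0"
proof -
  have p: "p > 0" using j by simp
  have "\<exists>k<n. \<not> p dvd a k + j + (p - 1) * b k"
  proof (rule ccontr)
    assume "\<not> ?thesis"
    then have "j * (p - j) \<le> j * a l + (p - j) * b l" if "l < n" for l
      using mult_diff_le_weighted_exponents[OF j] that by blast
    then have "(\<Sum>l<n. j * (p - j)) \<le> (\<Sum>l<n. j * a l + (p - j) * b l)"
      by (intro sum_mono) simp
    also have "\<dots> = j * d + (p - j) * d"
      using deg by (simp add: sum.distrib flip: sum_distrib_left)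
    also have "\<dots> = p * d" using j by (simp flip: distrib_right)
    finally show False using small by simp
  qed
  then obtain k where "k < n" "\<not> p dvd a k + j + (p - 1) * b k" by blast
  then have "(\<Sum>w\<in>Bset n p. monomial n (\<lambda>l. a l + j + (p - 1) * b l) w) = 0"
    by (intro sum_monomial_Bset p)
  then show ?thesis
    by (simp add: monomial_add coord_prod_power cnj_monomial_Bset[OF p])
qed

lemma sum_homogeneous_shift_orthogonal:
  assumes f: "homogeneous n d f" and g: "homogeneous n d g"
    and j: "0 < j" "j < p" and small: "p * d < n * (j * (p - j))"
  shows "(\<Sum>w\<in>Bset n p. f w * coord_prod n w ^ j * cnj (g w)) = 0"
  using f
proof induction
  case zero
  then show ?case by simp
next
  case (monomial a c)
  show ?case
    using g
  proof induction
    case zero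
    then show ?case by simp
  next
    case (monomial b c')
    have "(\<Sum>w\<in>Bset n p. c * monomial n a w * coord_prod n w ^ j * cnj (c' * monomial n b w))
        = c * cnj c' *
          (\<Sum>w\<in>Bset n p. monomial n a w * coord_prod n w ^ j * cnj (monomial n b w))"
      by (simp add: sum_distrib_left mult_ac)
    then show ?case
      using sum_monomial_shift_orthogonal[OF j \<open>(\<Sum>l<n. a l) = d\<close> monomial small] by simp
  next
    case (add g h)
    then show ?case by (simp add: distrib_left sum.distrib)
  qed
next
  case (add f h)
  then show ?case by (simp add: distrib_right sum.distrib)
qed

lemma diff_one_le_mult_diff:
  fixes j p :: nat
  assumes "0 < j" "j < p"
  shows "p - 1 \<le> j * (p - j)"
proof -
  obtain x y where "j = Suc x" "p - j = Suc y" using assms by (metis Suc_pred zero_less_diff)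
  then show ?thesis using assms by simp
qed

lemma sum_powers_coord_prod_eq_0:
  assumes p: "p > 0" and t: "t \<in> roots p" and w: "w \<in> Bset n p" "coord_prod n w \<noteq> t"
  shows "(\<Sum>j<p. (inverse t * coord_prod n w) ^ j) = 0"
proof -
  have "inverse t * coord_prod n w \<noteq> 1"
    using w(2) roots_nonzero[OF p t] by (simp add: field_simps)
  moreover have "(inverse t * coord_prod n w) ^ p = 1"
    using roots_mult[OF p roots_inverse[OF p t] coord_prod_in_roots[OF p w(1)]] p
    by (simp add: roots_eq)
  ultimately show ?thesis by (simp add: geometric_sum)
qed

lemma homogeneous_eq_0_on_Bset:
  assumes p: "p > 0" and f: "homogeneous n d f" and small: "p * d < n * (p - 1)"
    and t: "t \<in> roots p"
    and level: "\<And>w. w \<in> Bset n p \<Longrightarrow> coord_prod n w = t \<Longrightarrow> f w = 0"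
    and w: "w \<in> Bset n p"
  shows "f w = 0"
proof -
  define S where "S j = (\<Sum>w\<in>Bset n p. f w * coord_prod n w ^ j * cnj (f w))" for j
  have S_eq_0: "S j = 0" if j: "0 < j" "j < p" for j
  proof -
    have "p * d < n * (j * (p - j))"
      using small diff_one_le_mult_diff[OF j] by (meson less_le_trans mult_le_mono2)
    then show ?thesis unfolding S_def by (rule sum_homogeneous_shift_orthogonal[OF f f j])
  qed
  have annihilated: "f w * (\<Sum>j<p. (inverse t * coord_prod n w) ^ j) = 0"
    if "w \<in> Bset n p" for w
    using level[OF that] sum_powers_coord_prod_eq_0[OF p t that] by (metis mult_eq_0_iff)
  have "of_real (\<Sum>w\<in>Bset n p. (norm (f w))\<^sup>2) = S 0"
    unfolding S_def of_real_sum complex_norm_square by simp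
  also have "\<dots> = (\<Sum>j<p. if j = 0 then S 0 else 0)" using p by simp
  also have "\<dots> = (\<Sum>j<p. inverse t ^ j * S j)" using S_eq_0 by (intro sum.cong) auto
  also have "\<dots> = (\<Sum>w\<in>Bset n p. f w * (\<Sum>j<p. (inverse t * coord_prod n w) ^ j) * cnj (f w))"
    unfolding S_def sum_distrib_left sum_distrib_right
    by (subst sum.swap) (simp add: power_mult_distrib mult_ac)
  also have "\<dots> = 0" by (intro sum.neutral ballI) (simp only: annihilated mult_zero_left)
  finally have "(\<Sum>w\<in>Bset n p. (norm (f w))\<^sup>2) = 0" using of_real_eq_0_iff by blast
  then show ?thesis using w finite_Bset[OF p] by (simp add: sum_nonneg_eq_0_iff)
qed

subsection \<open>Orthogonal covers\<close>

definition orthogonal_cover :: "nat \<Rightarrow> nat \<Rightarrow> 'i set \<Rightarrow> ('i \<Rightarrow> nat \<Rightarrow> complex) \<Rightarrow> bool" where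
  "orthogonal_cover n p I v \<longleftrightarrow>
    (\<forall>i\<in>I. v i \<in> Bset n p) \<and> (\<forall>w\<in>Bset n p. \<exists>i\<in>I. dotp n (v i) w = 0)"

lemma card_level_set_cover_ge:
  assumes p: "p > 0" and I: "finite I" and t: "t \<in> roots p"
    and cover: "\<And>w. w \<in> Bset n p \<Longrightarrow> coord_prod n w = t \<Longrightarrow> \<exists>i\<in>I. dotp n (v i) w = 0"
    and w: "w \<in> Bset n p" "\<And>i. i \<in> I \<Longrightarrow> dotp n (v i) w \<noteq> 0"
  shows "n * (p - 1) \<le> p * card I"
proof (rule ccontr)
  assume "\<not> ?thesis"
  then have "p * card I < n * (p - 1)" by simp
  moreover have "homogeneous n (card I) (\<lambda>w. \<Prod>i\<in>I. dotp n (v i) w)"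
    using homogeneous_prod[OF I homogeneous_dotp] by simp
  moreover have "(\<Prod>i\<in>I. dotp n (v i) w) = 0" if "w \<in> Bset n p" "coord_prod n w = t" for w
    using cover[OF that] I by simp
  ultimately have "(\<Prod>i\<in>I. dotp n (v i) w) = 0"
    using homogeneous_eq_0_on_Bset[OF p _ _ t _ w(1)] by blast
  then show False using w(2) I by simp
qed

lemma card_orthogonal_cover_class_ge:
  assumes n: "n > 0" and p: "prime p" and I: "finite I" and cover: "orthogonal_cover n p I v"
    and s: "s \<in> roots p"
  shows "n * (p - 1) \<le> p * card {i \<in> I. coord_prod n (v i) = s}"
proof -
  let ?I = "{i \<in> I. coord_prod n (v i) = s}"
  have p_gt_1: "p > 1" and p_pos: "p > 0" using prime_gt_1_nat[OF p] by simp_all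
  define t where "t = inverse s * orthogonality_const n p"
  have t: "t \<in> roots p"
    unfolding t_def orthogonality_const_def
    by (intro roots_mult roots_inverse omega_in_roots p_pos s)
  have orth: "coord_prod n (v i) * coord_prod n w = s * t"
    if "i \<in> I" "w \<in> Bset n p" "dotp n (v i) w = 0" for i w
    using dotp_eq_0_imp_coord_prod[OF p _ that(2,3)] cover that(1) roots_nonzero[OF p_pos s]
    by (simp add: orthogonal_cover_def t_def)
  have "1 \<noteq> omega p 1" using omega_eq_1_iff[OF p_pos, of 1] p_gt_1 by auto
  then have "\<exists>z\<in>roots p. z \<noteq> t" using one_in_roots[OF p_pos] omega_in_roots[OF p_pos] by metis
  then obtain w where w: "w \<in> Bset n p" "coord_prod n w \<noteq> t"
    unfolding coord_prod_image_Bset[OF p_pos n, symmetric] by blast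
  show ?thesis
  proof (rule card_level_set_cover_ge[OF p_pos _ t _ w(1)])
    show "finite ?I" using I by simp
    show "\<exists>i\<in>?I. dotp n (v i) w = 0" if w: "w \<in> Bset n p" "coord_prod n w = t" for w
    proof -
      obtain i where i: "i \<in> I" "dotp n (v i) w = 0"
        using cover w(1) by (auto simp: orthogonal_cover_def)
      then have "coord_prod n (v i) = s"
        using orth[OF i(1) w(1) i(2)] w(2) roots_nonzero[OF p_pos t] by simp
      then show ?thesis using i by blast
    qed
    show "dotp n (v i) w \<noteq> 0" if i: "i \<in> ?I" for i
    proof
      assume "dotp n (v i) w = 0"
      then have "s * coord_prod n w = s * t" using orth[of i w] w(1) i by simp
      then show False using w(2) roots_nonzero[OF p_pos s] by simp
    qed
  qed
qed

lemma card_orthogonal_cover_ge: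
  assumes n: "n > 0" and p: "prime p" and I: "finite I" and cover: "orthogonal_cover n p I v"
  shows "n * (p - 1) \<le> card I"
proof -
  have p_pos: "p > 0" using prime_gt_0_nat[OF p] .
  have "p * (n * (p - 1)) = (\<Sum>s\<in>roots p. n * (p - 1))" by (simp add: card_roots[OF p_pos])
  also have "\<dots> \<le> (\<Sum>s\<in>roots p. p * card {i \<in> I. coord_prod n (v i) = s})"
    by (intro sum_mono card_orthogonal_cover_class_ge[OF assms])
  also have "\<dots> = p * (\<Sum>s\<in>roots p. \<Sum>i\<in>{i \<in> I. coord_prod n (v i) = s}. 1)"
    by (simp add: sum_distrib_left)
  also have "(\<Sum>s\<in>roots p. \<Sum>i\<in>{i \<in> I. coord_prod n (v i) = s}. 1) = (\<Sum>i\<in>I. 1 :: nat)"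
    using cover coord_prod_image_Bset[OF p_pos n]
    by (intro sum.group I finite_roots p_pos) (auto simp: orthogonal_cover_def)
  finally show ?thesis using p_pos by simp
qed

text \<open>If no cover existed, the \<open>LEAST\<close> in \<^const>\<open>Kval\<close> would be unspecified.\<close>

lemma ex_orthogonal_cover:
  assumes "p > 1" and "p dvd n"
  shows "\<exists>k v. orthogonal_cover n p {1..k::nat} v"
proof -
  obtain h where "bij_betw h {1..card (Bset n p)} (Bset n p)"
    using ex_bij_betw_nat_finite_1[OF finite_Bset[of p n]] assms(1) by auto
  then have "orthogonal_cover n p {1..card (Bset n p)} h"
    using ex_orthogonal_vector_in_Bset[OF assms]
    unfolding orthogonal_cover_def bij_betw_def by (metis image_eqI image_iff)
  then show ?thesis by blast
qed

theorem theorem1: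
  fixes n p :: nat
  assumes "n > 0" and "prime p" and "p dvd n"
  shows "Kval n p \<ge> n * (p - 1)"
proof -
  have "\<exists>k v. orthogonal_cover n p {1..k::nat} v"
    by (rule ex_orthogonal_cover[OF prime_gt_1_nat[OF assms(2)] assms(3)])
  then have "\<exists>v. orthogonal_cover n p {1..Kval n p} v"
    unfolding Kval_def orthogonal_cover_def by (rule LeastI_ex)
  then obtain v where "orthogonal_cover n p {1..Kval n p} v" ..
  then have "n * (p - 1) \<le> card {1..Kval n p}"
    by (rule card_orthogonal_cover_ge[OF assms(1,2) finite_atLeastAtMost])
  then show ?thesis by simp
qed

end
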